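(* For any integers $r,t\ge 1$ and any integer $n\ge 3$, $$\dim_s(K_{r,t}\times K_n)=n(r+t-1).$$
   Context: All graphs are finite and simple; $d_G(x,y)$ is the number of edges of a shortest $x$–$y$ path. In a connected graph $G$, a vertex $w$ strongly resolves two different vertices $u,v$ if $d_G(w,u)=d_G(w,v)+d_G(v,u)$ or $d_G(w,v)=d_G(w,u)+d_G(u,v)$. A set $S$ of vertices is a strong metric generator if every two different vertices are strongly resolved by some vertex of $S$; the strong metric dimension $\dim_s(G)$ is the smallest cardinality of a strong metric generator. $K_{r,t}$ is the complete bipartite graph with parts of sizes $r$ and $t$, and $K_n$ is the complete graph of order $n$. The direct product $G\times H$ has vertex set $V(G)\times V(H)$, with $(g,h)\sim(g',h')$ iff $gg'\in E(G)$ and $hh'\in E(H)$. *)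

theory Defs
  imports "Graph_Theory.Graph_Theory"
begin

text \<open>
  Finite simple graphs are the locale \<^locale>\<open>graph\<close>: finite symmetric digraphs without loops and
  without parallel arcs, so that an edge is a pair of opposite arcs and adjacency is
  \<^const>\<open>dominates\<close>.
\<close>

text \<open>
  The library's shortest path distance with every arc of weight 1. It is infinite exactly if there
  is no path; otherwise it is the length of a shortest path (see below).
\<close>

definition graph_dist :: "('a, 'b) pre_digraph \<Rightarrow> 'a \<Rightarrow> 'a \<Rightarrow> ereal" where
  "graph_dist G = wf_digraph.\<mu> G (\<lambda>_. 1)"

definition strongly_resolves :: "('a, 'b) pre_digraph \<Rightarrow> 'a \<Rightarrow> 'a \<Rightarrow> 'a \<Rightarrow> bool" where
  "strongly_resolves G w u v \<longleftrightarrow>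
     graph_dist G w u = graph_dist G w v + graph_dist G v u \<or>
     graph_dist G w v = graph_dist G w u + graph_dist G u v"

definition strong_metric_generator :: "('a, 'b) pre_digraph \<Rightarrow> 'a set \<Rightarrow> bool" where
  "strong_metric_generator G S \<longleftrightarrow> S \<subseteq> verts G \<and>
     (\<forall>u \<in> verts G. \<forall>v \<in> verts G. u \<noteq> v \<longrightarrow> (\<exists>w \<in> S. strongly_resolves G w u v))"

text \<open>Only meaningful for connected finite graphs.\<close>

definition strong_metric_dim :: "('a, 'b) pre_digraph \<Rightarrow> nat" where
  "strong_metric_dim G = (LEAST k. \<exists>S. strong_metric_generator G S \<and> card S = k)"

definition direct_product ::
  "('a, 'c) pre_digraph \<Rightarrow> ('b, 'd) pre_digraph \<Rightarrow> ('a \<times> 'b, ('a \<times> 'b) \<times> ('a \<times> 'b)) pre_digraph" where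
  "direct_product G H = with_proj
     \<lparr> pverts = verts G \<times> verts H,
       parcs = {((g, h), (g', h')). g \<rightarrow>\<^bsub>G\<^esub> g' \<and> h \<rightarrow>\<^bsub>H\<^esub> h'} \<rparr>"

lemma verts_direct_product [simp]: "verts (direct_product G H) = verts G \<times> verts H"
  by (simp add: direct_product_def)

lemma direct_product_adj [simp]:
  "(g, h) \<rightarrow>\<^bsub>direct_product G H\<^esub> (g', h') \<longleftrightarrow> g \<rightarrow>\<^bsub>G\<^esub> g' \<and> h \<rightarrow>\<^bsub>H\<^esub> h'"
  by (simp add: direct_product_def)

lemma graph_direct_product:
  assumes "graph G" "graph H"
  shows "graph (direct_product G H)"
proof -
  interpret G: graph G by fact
  interpret H: graph H by fact
  let ?P = "\<lparr> pverts = verts G \<times> verts H,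
       parcs = {((g, h), (g', h')). g \<rightarrow>\<^bsub>G\<^esub> g' \<and> h \<rightarrow>\<^bsub>H\<^esub> h'} \<rparr>"
  have sub: "parcs ?P \<subseteq> pverts ?P \<times> pverts ?P"
    using G.adj_in_verts H.adj_in_verts by fastforce
  have "finite (parcs ?P)"
    by (rule finite_subset[OF sub]) simp
  moreover have "sym (parcs ?P)"
    using G.sym_arcs H.sym_arcs by (auto simp: symmetric_def sym_def)
  moreover have "\<not> g \<rightarrow>\<^bsub>G\<^esub> g" for g
    using G.adj_not_same by blast
  ultimately have "pair_graph ?P"
    using sub
    by unfold_locales (auto simp add: symmetric_def subset_iff split_paired_all simp del: split_paired_All)
  then show ?thesis
    unfolding direct_product_def by (rule pair_graph.pair_graphD_graph)
qed

lemma graph_dist_shortest_path: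
  assumes "graph G" "u \<rightarrow>\<^sup>*\<^bsub>G\<^esub> v"
  obtains p where "pre_digraph.apath G u p v" "graph_dist G u v = ereal (real (length p))"
    "\<And>q. pre_digraph.apath G u q v \<Longrightarrow> length p \<le> length q"
proof -
  interpret graph G by fact
  have cost: "awalk_cost (\<lambda>_. 1) p = real (length p)" for p :: "'b list"
    by (induct p) auto
  obtain p where p: "apath u p v" "graph_dist G u v = ereal (awalk_cost (\<lambda>_. 1) p)"
    using min_cost_awalk[OF assms(2), of "\<lambda>_. 1"] by (auto simp: graph_dist_def)
  have "length p \<le> length q" if "apath u q v" for q
    using min_cost_le_walk_cost[of u q v "\<lambda>_. 1"] that p(2)
    by (auto simp: apath_def graph_dist_def cost)
  with p that show thesis by (simp add: cost)
qed

lemma strong_metric_generator_verts: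
  assumes "graph G"
  shows "strong_metric_generator G (verts G)"
proof -
  interpret graph G by fact
  have "graph_dist G u u = 0" if "u \<in> verts G" for u
  proof -
    have "u \<rightarrow>\<^sup>*\<^bsub>G\<^esub> u" "apath u [] u" using that by (auto simp: apath_Nil_iff)
    then show ?thesis
      using graph_dist_shortest_path[OF \<open>graph G\<close>, of u u]
      by (metis le_zero_eq list.size(3) of_nat_0 zero_ereal_def)
  qed
  then show ?thesis
    by (auto simp: strong_metric_generator_def strongly_resolves_def intro!: bexI)
qed

lemma connected_direct_product_complete:
  assumes "K\<^bsub>r,t\<^esub> G" "K\<^bsub>n\<^esub> H" "1 \<le> r" "1 \<le> t" "3 \<le> n"
  shows "connected (direct_product G H)"
proof -
  interpret H: graph H using assms by (simp add: complete_digraph_def)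
  let ?P = "direct_product G H"
  interpret P: graph ?P
    using assms by (simp add: complete_digraph_def complete_bipartite_digraph_def graph_direct_product)
  obtain U V where UV: "verts G = U \<union> V" "card U = r" "card V = t"
    and G: "arcs_ends G = U \<times> V \<union> V \<times> U"
    using assms by (auto simp: complete_bipartite_digraph_def)
  have H: "arcs_ends H = {(u,v). (u,v) \<in> verts H \<times> verts H \<and> u \<noteq> v}" "card (verts H) = n"
    using assms by (auto simp: complete_digraph_def)
  obtain a0 b0 where ab: "a0 \<in> U" "b0 \<in> V"
    using UV assms by (metis card.empty ex_in_conv not_one_le_zero)
  have third: "\<exists>k \<in> verts H. k \<noteq> i \<and> k \<noteq> j" for i j
  proof (rule ccontr)
    assume "\<not> ?thesis"
    then have "verts H \<subseteq> {i, j}" by auto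
    then have "card (verts H) \<le> card {i, j}" by (rule card_mono[rotated]) simp
    also have "\<dots> \<le> 2" by (simp add: card_insert_if)
    finally show False using H assms by simp
  qed
  have two: "(x, i) \<rightarrow>\<^sup>*\<^bsub>?P\<^esub> (y, j)"
    if "z \<in> verts G" "x \<rightarrow>\<^bsub>G\<^esub> z" "z \<rightarrow>\<^bsub>G\<^esub> y" "i \<in> verts H" "j \<in> verts H" for x y z i j
  proof -
    obtain k where "k \<in> verts H" "k \<noteq> i" "k \<noteq> j" using third by blast
    with that H have "(x, i) \<rightarrow>\<^bsub>?P\<^esub> (z, k)" "(z, k) \<rightarrow>\<^bsub>?P\<^esub> (y, j)" by auto
    then show ?thesis using P.reachable_trans P.reachable_adjI by blast
  qed
  have same: "(x, i) \<rightarrow>\<^sup>*\<^bsub>?P\<^esub> (y, j)"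
    if "x \<in> U \<and> y \<in> U \<or> x \<in> V \<and> y \<in> V" "i \<in> verts H" "j \<in> verts H" for x y i j
    using that two[of b0 x y i j] two[of a0 x y i j] ab by (auto simp: G UV)
  have diff: "(x, i) \<rightarrow>\<^sup>*\<^bsub>?P\<^esub> (y, j)"
    if xy: "x \<in> U \<and> y \<in> V \<or> x \<in> V \<and> y \<in> U" and ij: "i \<in> verts H" "j \<in> verts H" for x y i j
  proof -
    obtain k where k: "k \<in> verts H" "k \<noteq> i" using third by blast
    then have "(x, i) \<rightarrow>\<^bsub>?P\<^esub> (y, k)" using xy ij H by (auto simp: G)
    moreover have "(y, k) \<rightarrow>\<^sup>*\<^bsub>?P\<^esub> (y, j)" using same xy ij k by blast
    ultimately show ?thesis using P.reachable_trans P.reachable_adjI by blast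
  qed
  have "strongly_connected ?P"
  proof (rule strongly_connectedI)
    show "verts ?P \<noteq> {}" using ab third by (auto simp: UV)
    fix p q assume "p \<in> verts ?P" "q \<in> verts ?P"
    then show "p \<rightarrow>\<^sup>*\<^bsub>?P\<^esub> q"
      using same diff by (cases p; cases q) (auto simp: UV)
  qed
  then show ?thesis
    by (simp add: connected_def strongly_connected_def P.reachable_mk_symmetric_eq[OF P.sym_arcs])
qed

end

theory Submission
  imports Defs
begin

text \<open>
  Call the vertices of \<open>K\<^bsub>r,t\<^esub> \<times> K\<^bsub>n\<^esub>\<close> with the same second coordinate a layer. An arc joins
  opposite parts of \<open>K\<^bsub>r,t\<^esub>\<close> and different layers, and \<open>n \<ge> 3\<close> leaves a further layer
  besides any given two. So the distance of two different vertices is 2 if their first coordinates lie in the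
  same part, and otherwise 1 in different layers and 3 in the same layer (\<open>graph_dist_product\<close>).

  Two different vertices \<open>u\<close>, \<open>v\<close> of one layer are mutually maximally distant: no shortest path
  from either to the other can be prolonged. Hence only \<open>u\<close> and \<open>v\<close> themselves strongly resolve the
  pair (\<open>resolved_in_layer\<close>), and a strong metric generator misses at most one vertex of each of
  the \<open>n\<close> layers, which have \<open>r + t\<close> vertices each. Conversely, missing the same vertex \<open>a\<close> of
  \<open>K\<^bsub>r,t\<^esub>\<close> in every layer is possible (\<open>generator_avoiding_vertex\<close>): if \<open>b\<close> is opposite to \<open>a\<close>, then
  \<open>(b, i), (a, j), (z, k), (a, i)\<close> is, for suitable \<open>z\<close> and \<open>k\<close>, a shortest path of length 3 that
  passes through \<open>(a, j)\<close>, so \<open>(b, i)\<close> strongly resolves \<open>(a, i)\<close> and \<open>(a, j)\<close>.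
\<close>

text \<open>
  Powers of the adjacency relation turn the search for short walks into the search for
  intermediate vertices, without mentioning arcs.
\<close>

lemma (in wf_digraph) relpow_arcs_ends_iff_awalk:
  assumes "u \<in> verts G"
  shows "(u, v) \<in> arcs_ends G ^^ k \<longleftrightarrow> (\<exists>p. awalk u p v \<and> length p = k)"
  using assms
proof (induction k arbitrary: u)
  case 0
  then show ?case by (auto simp: awalk_Nil_iff)
next
  case (Suc k)
  show ?case
  proof
    assume "(u, v) \<in> arcs_ends G ^^ Suc k"
    then obtain z where z: "u \<rightarrow>\<^bsub>G\<^esub> z" "(z, v) \<in> arcs_ends G ^^ k"
      by (blast elim: relpow_Suc_E2)
    with Suc.IH[of z] obtain p where "awalk z p v" "length p = k"
      by (auto dest: adj_in_verts)
    moreover from z obtain e where "e \<in> arcs G" "tail G e = u" "head G e = z"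
      by (auto simp: arcs_ends_conv)
    ultimately have "awalk u (e # p) v \<and> length (e # p) = Suc k"
      by (simp add: awalk_Cons_iff)
    then show "\<exists>p. awalk u p v \<and> length p = Suc k" by blast
  next
    assume "\<exists>p. awalk u p v \<and> length p = Suc k"
    then obtain e p where "e \<in> arcs G" "tail G e = u" "awalk (head G e) p v" "length p = k"
      by (auto simp: length_Suc_conv awalk_Cons_iff)
    with Suc.IH[of "head G e"] in_arcs_imp_in_arcs_ends[of e]
    show "(u, v) \<in> arcs_ends G ^^ Suc k"
      by (metis awalk_hd_in_verts relpow_Suc_I2)
  qed
qed

lemma graph_dist_eqI:
  assumes "graph G" "u \<in> verts G" "(u, v) \<in> arcs_ends G ^^ k"
    and min: "\<And>m. m < k \<Longrightarrow> (u, v) \<notin> arcs_ends G ^^ m"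
  shows "graph_dist G u v = real k"
proof -
  interpret graph G by fact
  have cost: "awalk_cost (\<lambda>_. 1) p = real (length p)" for p :: "'b list"
    by (induct p) auto
  obtain q where q: "awalk u q v" "length q = k"
    using assms by (auto simp: relpow_arcs_ends_iff_awalk)
  then have "u \<rightarrow>\<^sup>*\<^bsub>G\<^esub> v" by (auto simp: reachable_awalk)
  then obtain p where p: "apath u p v" "graph_dist G u v = real (length p)"
    using graph_dist_shortest_path[OF \<open>graph G\<close>] by metis
  have "k \<le> length p"
    using min[of "length p"] p(1) assms(2)
    by (auto simp: relpow_arcs_ends_iff_awalk apath_def not_less[symmetric])
  moreover have "graph_dist G u v \<le> real k"
    using min_cost_le_walk_cost[OF q(1), of "\<lambda>_. 1"] q(2) by (simp add: graph_dist_def cost)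
  ultimately show ?thesis using p(2) by simp
qed

locale bipartite_times_complete =
  fixes G :: "('a, 'c) pre_digraph" and H :: "('b, 'd) pre_digraph" and U V :: "'a set"
  assumes graph_G: "graph G" and graph_H: "graph H"
    and verts_G: "verts G = U \<union> V" and disjoint_parts: "U \<inter> V = {}"
    and parts_nonempty: "U \<noteq> {}" "V \<noteq> {}"
    and arcs_G: "arcs_ends G = U \<times> V \<union> V \<times> U"
    and arcs_H: "arcs_ends H = {(i, j). (i, j) \<in> verts H \<times> verts H \<and> i \<noteq> j}"
    and card_H: "3 \<le> card (verts H)"
begin

abbreviation P where "P \<equiv> direct_product G H"

lemma graph_P: "graph P"
  using graph_G graph_H by (rule graph_direct_product)

lemma finite_verts_G: "finite (verts G)"
proof -
  interpret graph G by (rule graph_G)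
  show ?thesis by simp
qed

lemma finite_verts_H: "finite (verts H)"
proof -
  interpret graph H by (rule graph_H)
  show ?thesis by simp
qed

lemma adj_iff:
  "(x, i) \<rightarrow>\<^bsub>P\<^esub> (y, j) \<longleftrightarrow>
     x \<in> verts G \<and> y \<in> verts G \<and> (x \<in> U \<longleftrightarrow> y \<notin> U) \<and> i \<in> verts H \<and> j \<in> verts H \<and> i \<noteq> j"
  using disjoint_parts by (auto simp: arcs_G arcs_H verts_G)

lemma third_layer: obtains k where "k \<in> verts H" "k \<noteq> i" "k \<noteq> j"
proof -
  have "card {i, j} < card (verts H)"
    using card_H by (auto simp: card_insert_if)
  then have "\<not> verts H \<subseteq> {i, j}"
    using card_mono[of "{i, j}" "verts H"] by auto
  then show thesis using that by blast
qed

lemma opposite_vertex: obtains z where "z \<in> verts G" "z \<in> U \<longleftrightarrow> x \<notin> U"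
  using parts_nonempty disjoint_parts verts_G by (cases "x \<in> U") auto

definition layered_dist :: "'a \<times> 'b \<Rightarrow> 'a \<times> 'b \<Rightarrow> nat" where
  "layered_dist p q =
     (if p = q then 0
      else if fst p \<in> U \<longleftrightarrow> fst q \<in> U then 2
      else if snd p \<noteq> snd q then 1 else 3)"

lemma two_steps_iff:
  assumes "x \<in> verts G" "i \<in> verts H" "y \<in> verts G" "j \<in> verts H"
  shows "((x, i), (y, j)) \<in> arcs_ends P ^^ 2 \<longleftrightarrow> (x \<in> U \<longleftrightarrow> y \<in> U)"
proof
  assume "((x, i), (y, j)) \<in> arcs_ends P ^^ 2"
  then obtain z k where "(x, i) \<rightarrow>\<^bsub>P\<^esub> (z, k)" "(z, k) \<rightarrow>\<^bsub>P\<^esub> (y, j)"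
    by (auto simp: numeral_2_eq_2)
  then show "x \<in> U \<longleftrightarrow> y \<in> U" by (auto simp only: adj_iff)
next
  assume same: "x \<in> U \<longleftrightarrow> y \<in> U"
  obtain z where "z \<in> verts G" "z \<in> U \<longleftrightarrow> x \<notin> U" by (rule opposite_vertex)
  moreover obtain k where "k \<in> verts H" "k \<noteq> i" "k \<noteq> j" by (rule third_layer)
  ultimately have "(x, i) \<rightarrow>\<^bsub>P\<^esub> (z, k)" "(z, k) \<rightarrow>\<^bsub>P\<^esub> (y, j)"
    using assms same by (simp_all only: adj_iff) auto
  then show "((x, i), (y, j)) \<in> arcs_ends P ^^ 2"
    by (auto simp only: numeral_2_eq_2 intro: relpow_Suc_I2 relpow_0_I)
qed

lemma graph_dist_product:
  assumes "p \<in> verts P" "q \<in> verts P"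
  shows "graph_dist P p q = real (layered_dist p q)"
proof (rule graph_dist_eqI[OF graph_P assms(1)])
  obtain x i y j where pq: "p = (x, i)" "q = (y, j)" by (cases p; cases q) auto
  have verts: "x \<in> verts G" "i \<in> verts H" "y \<in> verts G" "j \<in> verts H"
    using assms pq by auto
  note two = two_steps_iff[OF verts]
  have one: "((x, i), (y, j)) \<in> arcs_ends P ^^ 1 \<longleftrightarrow> (x \<in> U \<longleftrightarrow> y \<notin> U) \<and> i \<noteq> j"
    using verts by (simp only: relpow_1 adj_iff) auto
  have three: "((x, i), (y, j)) \<in> arcs_ends P ^^ 3" if "x \<in> U \<longleftrightarrow> y \<notin> U"
  proof -
    obtain k where k: "k \<in> verts H" "k \<noteq> j" by (rule third_layer)
    have "((x, i), (x, k)) \<in> arcs_ends P ^^ 2"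
      using two_steps_iff[of x i x k] verts k by blast
    moreover have "(x, k) \<rightarrow>\<^bsub>P\<^esub> (y, j)"
      using verts k that by (simp only: adj_iff) auto
    ultimately have "((x, i), (y, j)) \<in> arcs_ends P ^^ Suc 2"
      by (rule relpow_Suc_I)
    then show ?thesis by (simp add: eval_nat_numeral)
  qed
  show "(p, q) \<in> arcs_ends P ^^ layered_dist p q"
    using one two three by (auto simp: layered_dist_def pq simp del: relpow_1)
  fix m assume "m < layered_dist p q"
  moreover from this have "m = 0 \<or> m = 1 \<or> m = 2"
    by (auto simp: layered_dist_def split: if_splits)
  ultimately show "(p, q) \<notin> arcs_ends P ^^ m"
    using one two by (auto simp: layered_dist_def pq simp del: relpow_1 split: if_splits)
qed

lemma strongly_resolves_product_iff:
  assumes "w \<in> verts P" "u \<in> verts P" "v \<in> verts P"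
  shows "strongly_resolves P w u v \<longleftrightarrow>
     layered_dist w u = layered_dist w v + layered_dist v u \<or>
     layered_dist w v = layered_dist w u + layered_dist u v"
  unfolding strongly_resolves_def using assms
  by (simp add: graph_dist_product flip: of_nat_add)

text \<open>
  The distances never exceed 3, so a pair at distance 3 leaves no room for a third vertex. For a
  pair at distance 2, a third vertex resolving it would be at distance 1 from one and 3 from the
  other. By the former it lies in another layer and opposite to both, hence at distance 1 from both.
\<close>

lemma resolved_in_layer:
  assumes "w \<in> verts P" "(x, i) \<in> verts P" "(y, i) \<in> verts P" "x \<noteq> y"
    and "strongly_resolves P w (x, i) (y, i)"
  shows "w = (x, i) \<or> w = (y, i)"
  using assms(4,5) unfolding strongly_resolves_product_iff[OF assms(1-3)]
  by (cases w) (auto simp: layered_dist_def split: if_splits)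

lemma card_generator_ge:
  assumes "strong_metric_generator P S"
  shows "card (verts H) * (card (verts G) - 1) \<le> card S"
proof -
  have S: "S \<subseteq> verts P" using assms by (simp add: strong_metric_generator_def)
  have "inj_on snd (verts P - S)"
  proof (rule inj_onI)
    fix p q assume pq: "p \<in> verts P - S" "q \<in> verts P - S" "snd p = snd q"
    show "p = q"
    proof (rule ccontr)
      assume "p \<noteq> q"
      then obtain w where "w \<in> S" "strongly_resolves P w p q"
        using assms pq unfolding strong_metric_generator_def by blast
      moreover from this have "w \<in> verts P" using S by blast
      ultimately have "w = p \<or> w = q"
        using resolved_in_layer[of w "fst p" "snd p" "fst q"] pq \<open>p \<noteq> q\<close>
        by (metis DiffD1 prod.collapse)
      with \<open>w \<in> S\<close> pq show False by blast
    qed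
  qed
  then have "card (verts P - S) \<le> card (verts H)"
    by (rule card_inj_on_le) (auto simp: finite_verts_H)
  moreover have "card (verts P - S) = card (verts P) - card S"
    using S finite_verts_G finite_verts_H by (intro card_Diff_subset) (auto intro: finite_subset)
  ultimately show ?thesis
    by (simp add: card_cartesian_product algebra_simps)
qed

lemma generator_avoiding_vertex:
  assumes "a \<in> verts G"
  shows "strong_metric_generator P ((verts G - {a}) \<times> verts H)"
  unfolding strong_metric_generator_def
proof (intro conjI ballI impI)
  let ?S = "(verts G - {a}) \<times> verts H"
  show "?S \<subseteq> verts P" by auto
  fix u v assume uv: "u \<in> verts P" "v \<in> verts P" "u \<noteq> v"
  show "\<exists>w \<in> ?S. strongly_resolves P w u v"
  proof (cases "u \<in> ?S \<or> v \<in> ?S")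
    case True
    \<comment> \<open>Every vertex strongly resolves each pair that it belongs to.\<close>
    moreover have "strongly_resolves P u u v" "strongly_resolves P v u v"
      using uv by (simp_all only: strongly_resolves_product_iff) (simp_all add: layered_dist_def)
    ultimately show ?thesis by blast
  next
    case False
    then obtain i j where ij: "u = (a, i)" "v = (a, j)" "i \<in> verts H" "j \<in> verts H" "i \<noteq> j"
      using uv by auto
    obtain b where b: "b \<in> verts G" "b \<in> U \<longleftrightarrow> a \<notin> U" by (rule opposite_vertex)
    have "strongly_resolves P (b, i) u v"
      using ij b assms by (subst strongly_resolves_product_iff) (auto simp: layered_dist_def)
    moreover have "(b, i) \<in> ?S" using ij b by auto
    ultimately show ?thesis by blast
  qed
qed

lemma strong_metric_dim_product:
  "strong_metric_dim P = card (verts H) * (card (verts G) - 1)"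
  unfolding strong_metric_dim_def
proof (rule Least_equality)
  obtain a where a: "a \<in> verts G" using parts_nonempty verts_G by blast
  then have "card ((verts G - {a}) \<times> verts H) = card (verts H) * (card (verts G) - 1)"
    by (simp add: card_cartesian_product)
  then show "\<exists>S. strong_metric_generator P S \<and> card S = card (verts H) * (card (verts G) - 1)"
    using generator_avoiding_vertex[OF a] by blast
qed (use card_generator_ge in blast)

end

theorem theorem12:
  fixes r t n :: nat
    and G :: "('a, 'c) pre_digraph"
    and H :: "('b, 'd) pre_digraph"
  assumes "1 \<le> r" and "1 \<le> t" and "3 \<le> n"
    and "K\<^bsub>r,t\<^esub> G" and "K\<^bsub>n\<^esub> H"
  shows "strong_metric_dim (direct_product G H) = n * (r + t - 1)"
proof -
  obtain U V where UV: "verts G = U \<union> V" "U \<inter> V = {}" "card U = r" "card V = t"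
      "arcs_ends G = U \<times> V \<union> V \<times> U" and "graph G"
    using assms(4) by (auto simp: complete_bipartite_digraph_def)
  have H: "graph H" "card (verts H) = n"
      "arcs_ends H = {(i, j). (i, j) \<in> verts H \<times> verts H \<and> i \<noteq> j}"
    using assms(5) by (auto simp: complete_digraph_def)
  interpret bipartite_times_complete G H U V
    by (rule bipartite_times_complete.intro) (use assms UV H \<open>graph G\<close> in auto)
  have "card (verts G) = r + t"
    using UV finite_verts_G by (simp add: card_Un_disjoint)
  then show ?thesis
    using strong_metric_dim_product H by simp
qed

end
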